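(* In the setting described in the context, suppose the following hold. (1) There exists $\gamma\in(0,1)$ such that $T_\theta(\cdot;t,z)$ is $\gamma$-contractive in $u$ for all $t\in[0,T]$, $z\in\mathbb{R}^n$, $\theta\in\mathbb{R}^p$; and $T_\theta$ is continuously differentiable with respect to $\theta,t,u,z$. (2) There is $\beta>0$ such that for all $\theta,t,u,z$ the matrix $M_\theta=\frac{\partial T_\theta}{\partial\theta}(u;t,z)\in\mathbb{R}^{m\times p}$ satisfies $\sqrt{\gamma/\beta}\le\sigma_{\min}(M_\theta)\le\sigma_{\max}(M_\theta)\le 1/\sqrt{\beta}$, where $\gamma$ is the contraction factor in (1). (3) There exists $\eta>0$ such that for all initial conditions $x$, all $t\in[0,T]$ and all $\theta$, $\|\nabla_uL(t,z_x,u_\theta^\star)+\nabla_uf^\top p_x\|\ge\eta$, where all quantities are evaluated at time $t$ along the trajectory $z_x$ with control $u_\theta^\star$. (4) Let $C_v=\frac1T\int_0^Tv_\theta(t)\,dt$ and $C_w=\frac1T\int_0^Tw_\theta(t)\,dt$. For all $x$ and $\theta$, the functions $v_\theta,w_\theta$ are entrywise in $L^2[0,T]$ with respect to $t$, and for all $t\in[0,T]$ $$\|v_\theta(t)-C_v\|<\|M_\theta v_\theta(t)\|\sqrt{\lambda_--\gamma\lambda_+},\qquad \|w_\theta(t)-C_w\|<\|M_\theta w_\theta(t)\|\sqrt{\lambda_--\gamma\lambda_+}.$$ Here $M_\theta$ is evaluated at $(u_\theta^\star(t,z_x(t));t,z_x(t))$, and $\lambda_-,\lambda_+$ are the uniform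 eigenvalue bounds described in the context. Then for every $x$ and $\theta$, the negative JFB approximation of the gradient $$-\frac{d\tilde J_x(\theta)}{d\theta}=-\int_0^Tw_\theta(t)\,dt$$ is a descent direction for $J_x(\theta)$ with respect to $\theta$, that is, $\left\langle \frac{dJ_x(\theta)}{d\theta},\,-\frac{d\tilde J_x(\theta)}{d\theta}\right\rangle<0$.
   Context: Norms are Euclidean (spectral for matrices); $\sigma_{\min},\sigma_{\max}$ denote the smallest and largest singular values (for $M_\theta\in\mathbb{R}^{m\times p}$, $\sigma_{\min}(M_\theta)^2=\lambda_{\min}(M_\theta M_\theta^\top)$). Optimal control problem. $T>0$ is a fixed time horizon (not to be confused with the operator $T_\theta$). $f(t,z,u)\in\mathbb{R}^n$ is the dynamics, $L(t,z,u)\in\mathbb{R}$ the running cost and $G(z)\in\mathbb{R}$ the terminal cost, for $t\in[0,T]$, $z\in\mathbb{R}^n$, $u\in\mathbb{R}^m$, all differentiable as needed. The generalized Hamiltonian is $\mathcal{H}(t,z,p,u)=-\langle p,f(t,z,u)\rangle-L(t,z,u)$. A function $\phi_\theta(t,z)\in\mathbb{R}$ with parameters $\theta\in\mathbb{R}^p$ parameterizes the value function. For $\alpha>0$ define the operator $$T_\theta(u;t,z)=u+\alpha\nabla_u\mathcal{H}(t,z,\nabla_z\phi_\theta(t,z),u),\qquad u\in\mathbb{R}^m.$$ The feedback control $u_\theta^\star=u_\theta^\star(t,z)\in\mathrm{arg\,max}_u\,\mathcal{H}(t,z,\nabla_z\phi_\theta(t,z),u)$ is the fixed point $u_\theta^\star=T_\theta(u_\theta^\star;t,z)$.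 For an initial condition $x\in\mathbb{R}^n$, the trajectory $z_x$ solves $\dot z_x=f(t,z_x,u_\theta^\star)$, $z_x(0)=x$ (with $u_\theta^\star=u_\theta^\star(t,z_x(t))$), and $$J_x(\theta)=\int_0^TL(s,z_x,u_\theta^\star)\,ds+G(z_x(T)).$$ Gradients. Let $\mathcal{J}_\theta=I-\frac{\partial T_\theta}{\partial u}(u_\theta^\star;t,z)$. The implicit derivative of the fixed point is $\frac{du_\theta^\star}{d\theta}(t,z)=\mathcal{J}_\theta^{-1}\frac{\partial T_\theta}{\partial\theta}(u_\theta^\star;t,z)\in\mathbb{R}^{m\times p}$. Along the trajectory, with everything evaluated at $(t,z_x(t),u_\theta^\star(t,z_x(t)))$, set $$v_\theta(t)=\Big(\frac{du_\theta^\star}{d\theta}\Big)^{\top}\big(\nabla_uL+\nabla_uf^\top p_x(t)\big),\qquad w_\theta(t)=\Big(\frac{\partial T_\theta}{\partial\theta}\Big)^{\top}\big(\nabla_uL+\nabla_uf^\top p_x(t)\big),$$ where $\nabla_u f$ is the Jacobian of $f$ in $u$ and $p_x:[0,T]\to\mathbb{R}^n$ is the adjoint trajectory, i.e. the solution of the adjoint equation corresponding to $J_x$, for which the true gradient has the representation $$\frac{dJ_x(\theta)}{d\theta}=\int_0^Tv_\theta(t)\,dt.$$ This representation is taken as part of the setting. The Jacobian-Free Backpropagation (JFB) approximation of the gradient is $\frac{d\tilde J_x(\theta)}{d\theta}=\int_0^Tw_\theta(t)\,dt$. Eigenvalue bounds. $0<\lambda_-<\lambda_+$ are constants with $\lambda_-I\preceq(M_\theta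 M_\theta^\top)^{-1}\preceq\lambda_+I$ for all $t,z,u,\theta$ (such constants exist under the singular value bounds in hypothesis (2)). *)

theory Defs
  imports "HOL-Analysis.Analysis"
begin

section \<open>Calculus and linear algebra\<close>

definition grad :: "('a::real_inner \<Rightarrow> real) \<Rightarrow> 'a \<Rightarrow> 'a" where
  "grad F x = (THE D. GDERIV F x :> D)"

text \<open>
  Derivatives are taken within \<^term>\<open>S\<close>, so that one-sided derivatives are used at
  the end points of the time interval.
\<close>

definition C1_on :: "'a::real_normed_vector set \<Rightarrow> ('a \<Rightarrow> 'b::real_normed_vector) \<Rightarrow> bool" where
  "C1_on S F \<longleftrightarrow> (\<exists>F' :: 'a \<Rightarrow> 'a \<Rightarrow>\<^sub>L 'b.
     (\<forall>x\<in>S. (F has_derivative blinfun_apply (F' x)) (at x within S)) \<and> continuous_on S F')"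

definition square_integrable_on :: "(real \<Rightarrow> real) \<Rightarrow> real set \<Rightarrow> bool" where
  "square_integrable_on g S \<longleftrightarrow>
     g \<in> borel_measurable (lebesgue_on S) \<and> integrable (lebesgue_on S) (\<lambda>t. (g t)\<^sup>2)"

definition eigenvalues :: "real^'n^'n \<Rightarrow> real set" where
  "eigenvalues A = {c. \<exists>v. v \<noteq> 0 \<and> A *v v = c *\<^sub>R v}"

text \<open>
  The singular values of an \<open>m \<times> p\<close> matrix \<open>M\<close> are the square roots of the \<open>m\<close> eigenvalues
  of \<open>M M\<^sup>T\<close>; in particular \<open>\<sigma>_min\<close> vanishes whenever \<open>p < m\<close>.
\<close>

definition sigma_min :: "real^'p^'m \<Rightarrow> real" where
  "sigma_min M = sqrt (Min (eigenvalues (M ** transpose M)))"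

definition sigma_max :: "real^'p^'m \<Rightarrow> real" where
  "sigma_max M = sqrt (Max (eigenvalues (M ** transpose M)))"

definition loewner_le :: "real^'n^'n \<Rightarrow> real^'n^'n \<Rightarrow> bool" (infix "\<preceq>\<^sub>L" 50) where
  "A \<preceq>\<^sub>L B \<longleftrightarrow> transpose (B - A) = B - A \<and> (\<forall>x. 0 \<le> x \<bullet> ((B - A) *v x))"

section \<open>The optimal control problem\<close>

definition hamiltonian ::
  "(real \<Rightarrow> real^'n \<Rightarrow> real^'m \<Rightarrow> real^'n) \<Rightarrow> (real \<Rightarrow> real^'n \<Rightarrow> real^'m \<Rightarrow> real)
    \<Rightarrow> real \<Rightarrow> real^'n \<Rightarrow> real^'n \<Rightarrow> real^'m \<Rightarrow> real" where
  "hamiltonian f L t z p u = - (p \<bullet> f t z u) - L t z u"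

definition control_op ::
  "real \<Rightarrow> (real \<Rightarrow> real^'n \<Rightarrow> real^'m \<Rightarrow> real^'n) \<Rightarrow> (real \<Rightarrow> real^'n \<Rightarrow> real^'m \<Rightarrow> real)
    \<Rightarrow> (real^'p \<Rightarrow> real \<Rightarrow> real^'n \<Rightarrow> real)
    \<Rightarrow> real^'p \<Rightarrow> real^'m \<Rightarrow> real \<Rightarrow> real^'n \<Rightarrow> real^'m" where
  "control_op \<alpha> f L \<phi> \<theta> u t z = u + \<alpha> *\<^sub>R grad (hamiltonian f L t z (grad (\<phi> \<theta> t) z)) u"

definition is_feedback_control ::
  "real \<Rightarrow> real \<Rightarrow> (real \<Rightarrow> real^'n \<Rightarrow> real^'m \<Rightarrow> real^'n) \<Rightarrow> (real \<Rightarrow> real^'n \<Rightarrow> real^'m \<Rightarrow> real)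
    \<Rightarrow> (real^'p \<Rightarrow> real \<Rightarrow> real^'n \<Rightarrow> real) \<Rightarrow> real^'p \<Rightarrow> (real \<Rightarrow> real^'n \<Rightarrow> real^'m) \<Rightarrow> bool" where
  "is_feedback_control T \<alpha> f L \<phi> \<theta> us \<longleftrightarrow> (\<forall>t\<in>{0..T}. \<forall>z.
     is_arg_max (hamiltonian f L t z (grad (\<phi> \<theta> t) z)) (\<lambda>_. True) (us t z) \<and>
     us t z = control_op \<alpha> f L \<phi> \<theta> (us t z) t z)"

definition is_trajectory ::
  "real \<Rightarrow> (real \<Rightarrow> real^'n \<Rightarrow> real^'m \<Rightarrow> real^'n) \<Rightarrow> (real \<Rightarrow> real^'n \<Rightarrow> real^'m)
    \<Rightarrow> real^'n \<Rightarrow> (real \<Rightarrow> real^'n) \<Rightarrow> bool" where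
  "is_trajectory T f us x z \<longleftrightarrow> z 0 = x \<and>
     (\<forall>t\<in>{0..T}. (z has_vector_derivative f t (z t) (us t (z t))) (at t within {0..T}))"

definition cost ::
  "real \<Rightarrow> (real \<Rightarrow> real^'n \<Rightarrow> real^'m \<Rightarrow> real) \<Rightarrow> (real^'n \<Rightarrow> real)
    \<Rightarrow> (real \<Rightarrow> real^'n \<Rightarrow> real^'m) \<Rightarrow> (real \<Rightarrow> real^'n) \<Rightarrow> real" where
  "cost T L G us z = (LINT s|lebesgue_on {0..T}. L s (z s) (us s (z s))) + G (z T)"

text \<open>
  Adjoint equation of the closed-loop system, i.e. of the cost with running cost
  \<open>L(t, z, u(t, z))\<close> under the dynamics \<open>f(t, z, u(t, z))\<close>: the gradient in the state is a
  total one, which also differentiates the feedback law. Written out, it reads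
  \<open>p' = - (\<nabla>\<^sub>z f + \<nabla>\<^sub>u f \<nabla>\<^sub>z u)\<^sup>T p - \<nabla>\<^sub>z L - (\<nabla>\<^sub>z u)\<^sup>T \<nabla>\<^sub>u L\<close>.
\<close>

definition is_adjoint ::
  "real \<Rightarrow> (real \<Rightarrow> real^'n \<Rightarrow> real^'m \<Rightarrow> real^'n) \<Rightarrow> (real \<Rightarrow> real^'n \<Rightarrow> real^'m \<Rightarrow> real)
    \<Rightarrow> (real^'n \<Rightarrow> real) \<Rightarrow> (real \<Rightarrow> real^'n \<Rightarrow> real^'m) \<Rightarrow> (real \<Rightarrow> real^'n)
    \<Rightarrow> (real \<Rightarrow> real^'n) \<Rightarrow> bool" where
  "is_adjoint T f L G us z p \<longleftrightarrow> p T = grad G (z T) \<and>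
     (\<forall>t\<in>{0..T}. (p has_vector_derivative
        grad (\<lambda>y. hamiltonian f L t y (p t) (us t y)) (z t)) (at t within {0..T}))"

section \<open>Gradient and Jacobian-free gradient\<close>

text \<open>
  Below, \<open>\<T> \<theta> u t z\<close> stands for the operator \<^const>\<open>control_op\<close> with its data fixed.
\<close>

definition M_mat ::
  "(real^'p \<Rightarrow> real^'m \<Rightarrow> real \<Rightarrow> real^'n \<Rightarrow> real^'m)
    \<Rightarrow> real^'p \<Rightarrow> real^'m \<Rightarrow> real \<Rightarrow> real^'n \<Rightarrow> real^'p^'m" where
  "M_mat \<T> \<theta> u t z = jacobian (\<lambda>\<theta>'. \<T> \<theta>' u t z) (at \<theta>)"

definition J_mat ::
  "(real^'p \<Rightarrow> real^'m \<Rightarrow> real \<Rightarrow> real^'n \<Rightarrow> real^'m)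
    \<Rightarrow> real^'p \<Rightarrow> real^'m \<Rightarrow> real \<Rightarrow> real^'n \<Rightarrow> real^'m^'m" where
  "J_mat \<T> \<theta> u t z = mat 1 - jacobian (\<lambda>u'. \<T> \<theta> u' t z) (at u)"

definition du_dtheta ::
  "(real^'p \<Rightarrow> real^'m \<Rightarrow> real \<Rightarrow> real^'n \<Rightarrow> real^'m)
    \<Rightarrow> real^'p \<Rightarrow> real^'m \<Rightarrow> real \<Rightarrow> real^'n \<Rightarrow> real^'p^'m" where
  "du_dtheta \<T> \<theta> u t z = matrix_inv (J_mat \<T> \<theta> u t z) ** M_mat \<T> \<theta> u t z"

definition control_residual ::
  "(real \<Rightarrow> real^'n \<Rightarrow> real^'m \<Rightarrow> real^'n) \<Rightarrow> (real \<Rightarrow> real^'n \<Rightarrow> real^'m \<Rightarrow> real)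
    \<Rightarrow> real \<Rightarrow> real^'n \<Rightarrow> real^'m \<Rightarrow> real^'n \<Rightarrow> real^'m" where
  "control_residual f L t z u p =
     grad (L t z) u + transpose (jacobian (f t z) (at u)) *v p"

definition v_integrand ::
  "(real^'p \<Rightarrow> real^'m \<Rightarrow> real \<Rightarrow> real^'n \<Rightarrow> real^'m)
    \<Rightarrow> (real \<Rightarrow> real^'n \<Rightarrow> real^'m \<Rightarrow> real^'n) \<Rightarrow> (real \<Rightarrow> real^'n \<Rightarrow> real^'m \<Rightarrow> real)
    \<Rightarrow> real^'p \<Rightarrow> (real \<Rightarrow> real^'n \<Rightarrow> real^'m) \<Rightarrow> (real \<Rightarrow> real^'n) \<Rightarrow> (real \<Rightarrow> real^'n)
    \<Rightarrow> real \<Rightarrow> real^'p" where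
  "v_integrand \<T> f L \<theta> us z p t =
     transpose (du_dtheta \<T> \<theta> (us t (z t)) t (z t))
       *v control_residual f L t (z t) (us t (z t)) (p t)"

definition w_integrand ::
  "(real^'p \<Rightarrow> real^'m \<Rightarrow> real \<Rightarrow> real^'n \<Rightarrow> real^'m)
    \<Rightarrow> (real \<Rightarrow> real^'n \<Rightarrow> real^'m \<Rightarrow> real^'n) \<Rightarrow> (real \<Rightarrow> real^'n \<Rightarrow> real^'m \<Rightarrow> real)
    \<Rightarrow> real^'p \<Rightarrow> (real \<Rightarrow> real^'n \<Rightarrow> real^'m) \<Rightarrow> (real \<Rightarrow> real^'n) \<Rightarrow> (real \<Rightarrow> real^'n)
    \<Rightarrow> real \<Rightarrow> real^'p" where
  "w_integrand \<T> f L \<theta> us z p t =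
     transpose (M_mat \<T> \<theta> (us t (z t)) t (z t))
       *v control_residual f L t (z t) (us t (z t)) (p t)"

definition time_average :: "real \<Rightarrow> (real \<Rightarrow> 'a::euclidean_space) \<Rightarrow> 'a" where
  "time_average T g = (1 / T) *\<^sub>R (LINT t|lebesgue_on {0..T}. g t)"

definition descent_direction :: "('a::real_inner \<Rightarrow> real) \<Rightarrow> 'a \<Rightarrow> 'a \<Rightarrow> bool" where
  "descent_direction F \<theta> d \<longleftrightarrow> grad F \<theta> \<bullet> d < 0"

end

(*
  At a fixed time let g be the control residual, K the Jacobian of the operator in the control,
  B = M M^T and Q = B^-1. Then w = M^T g and v = M^T q with q - K^T q = g, where |K| <= gamma, so
  that v.w = Bq.g, M v = B q and M w = B g. The key point is the symmetric bound
    (lam_minus - gamma lam_plus) |Bq| |Bg| <= Bq.g .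
  Writing Bq.g = Bq.Q(Bq) - Bq.(q - g) bounds Bq.g below by (lam_minus - gamma lam_plus) |Bq|^2
  whenever |q - g| <= gamma |q|. This hypothesis only says that the sine of the angle between q
  and g is at most gamma, so the bound also holds for q and the projection of q to the line of g,
  and with the roles of q and g exchanged; the product of these two bounds is the claim.
  The deviation hypotheses then give |v - C_v| |w - C_w| < v.w, hence
    0 < v.w - (v - C_v).(w - C_w) = v.C_w + C_v.w - C_v.C_w ,
  and the right-hand side has time average C_v.C_w.
*)
theory Submission
  imports Defs
begin

text \<open>As a simp rule it would turn \<open>transpose A *v x\<close> into a row-vector product,
  while the arguments below keep the transpose visible.\<close>

declare transpose_matrix_vector [simp del]

section \<open>Transposes, symmetric spectra and Gram matrices\<close>

lemma inner_matrix_vector_transpose: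
  fixes A :: "real^'n^'m"
  shows "x \<bullet> (A *v y) = (transpose A *v x) \<bullet> y"
  by (simp add: dot_lmul_matrix transpose_matrix_vector)

text \<open>Cauchy-Schwarz applied to |K^T x|^2 = x . K K^T x leaves one factor |K^T x| to cancel.
  The transfer is needed because contractivity bounds K, while v involves its transpose.\<close>

lemma norm_transpose_mult_le:
  fixes K :: "real^'n^'m"
  assumes K: "\<And>x. norm (K *v x) \<le> c * norm x" and c: "0 \<le> c"
  shows "norm (transpose K *v x) \<le> c * norm x"
proof (cases "transpose K *v x = 0")
  case False
  have "(norm (transpose K *v x))\<^sup>2 = x \<bullet> (K *v (transpose K *v x))"
    by (simp add: inner_matrix_vector_transpose power2_norm_eq_inner)
  also have "\<dots> \<le> norm x * norm (K *v (transpose K *v x))"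
    by (rule norm_cauchy_schwarz)
  also have "\<dots> \<le> norm x * (c * norm (transpose K *v x))"
    by (intro mult_left_mono K) simp
  finally have "norm (transpose K *v x) * norm (transpose K *v x)
      \<le> c * norm x * norm (transpose K *v x)"
    by (simp add: power2_eq_square mult_ac)
  with False show ?thesis by simp
qed (use c in simp)

text \<open>\<open>Min\<close> is informative only on finite sets, so \<open>sigma_min\<close>
  depends on this. Eigenvectors for distinct eigenvalues are orthogonal, hence one per eigenvalue
  forms an independent, thus finite, set.\<close>

lemma finite_eigenvalues_symmetric:
  fixes A :: "real^'n^'n"
  assumes sym: "transpose A = A"
  shows "finite (eigenvalues A)"
proof -
  have "\<forall>c\<in>eigenvalues A. \<exists>v. v \<noteq> 0 \<and> A *v v = c *\<^sub>R v"
    by (auto simp: eigenvalues_def)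
  then obtain e where e: "\<And>c. c \<in> eigenvalues A \<Longrightarrow> e c \<noteq> 0 \<and> A *v e c = c *\<^sub>R e c"
    by metis
  have orth: "e c \<bullet> e d = 0" if "c \<in> eigenvalues A" "d \<in> eigenvalues A" "c \<noteq> d" for c d
  proof -
    have "d * (e c \<bullet> e d) = e c \<bullet> (A *v e d)"
      using e[OF that(2)] by simp
    also have "\<dots> = (A *v e c) \<bullet> e d"
      by (simp add: inner_matrix_vector_transpose sym)
    also have "\<dots> = c * (e c \<bullet> e d)"
      using e[OF that(1)] by simp
    finally show ?thesis using that(3) by simp
  qed
  have inj: "inj_on e (eigenvalues A)"
  proof (rule inj_onI)
    fix c d assume cd: "c \<in> eigenvalues A" "d \<in> eigenvalues A" "e c = e d"
    then have "e c \<bullet> e d \<noteq> 0" using e[of c] by simp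
    with orth cd show "c = d" by blast
  qed
  have "independent (e ` eigenvalues A)"
  proof (rule pairwise_orthogonal_independent)
    show "pairwise orthogonal (e ` eigenvalues A)"
      using orth by (fastforce simp: pairwise_def orthogonal_def)
    show "0 \<notin> e ` eigenvalues A" using e by force
  qed
  then have "finite (e ` eigenvalues A)" by (rule independent_imp_finite)
  then show ?thesis using inj by (rule finite_imageD)
qed

text \<open>A nonzero kernel vector would make 0 an eigenvalue and force the minimum, hence its
  \<open>sqrt\<close>, to be nonpositive.\<close>

lemma invertible_gram_if_sigma_min_pos:
  fixes M :: "real^'p^'m"
  assumes "0 < sigma_min M"
  shows "invertible (M ** transpose M)"
proof -
  let ?B = "M ** transpose M"
  have fin: "finite (eigenvalues ?B)"
    by (rule finite_eigenvalues_symmetric) (simp add: matrix_transpose_mul transpose_transpose)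
  have "x = 0" if "?B *v x = 0" for x
  proof (rule ccontr)
    assume "x \<noteq> 0"
    with that have "0 \<in> eigenvalues ?B" by (force simp: eigenvalues_def)
    with fin have "Min (eigenvalues ?B) \<le> 0" by (rule Min_le)
    with assms show False by (simp add: sigma_min_def)
  qed
  then show ?thesis
    by (simp add: invertible_left_inverse matrix_left_invertible_ker)
qed

section \<open>Quadratic form bounds and the symmetric pointwise estimate\<close>

lemma norm_mult_le_of_loewner_le:
  fixes Q :: "real^'n^'n"
  assumes sym: "transpose Q = Q" and nonneg: "\<And>x. 0 \<le> x \<bullet> (Q *v x)"
    and le: "\<And>x. x \<bullet> (Q *v x) \<le> c * (x \<bullet> x)" and c: "0 < c"
  shows "norm (Q *v x) \<le> c * norm x"
proof -
  let ?y = "Q *v x" and ?r = "c *\<^sub>R x - Q *v x"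
  have Qr: "Q *v ?r = c *\<^sub>R ?y - Q *v ?y"
    by (simp add: matrix_vector_mult_diff_distrib matrix_vector_mult_scaleR)
  have xQy: "x \<bullet> (Q *v ?y) = ?y \<bullet> ?y"
    by (simp add: inner_matrix_vector_transpose[of x] sym)
  \<comment> \<open>With \<open>R = c I - Q\<close>, the sum \<open>Q R Q + R Q R = c (c Q - Q\<^sup>2)\<close> is positive semidefinite.\<close>
  have "0 \<le> ?r \<bullet> (Q *v ?r)" by (rule nonneg)
  also have "\<dots> = c * (c * (x \<bullet> ?y) - ?y \<bullet> ?y) - (c * (?y \<bullet> ?y) - ?y \<bullet> (Q *v ?y))"
    by (simp add: Qr inner_diff_left inner_diff_right xQy algebra_simps)
  also have "\<dots> \<le> c * (c * (x \<bullet> ?y) - ?y \<bullet> ?y)"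
    using le[of ?y] by simp
  finally have "?y \<bullet> ?y \<le> c * (x \<bullet> ?y)"
    using c by (simp add: zero_le_mult_iff)
  also have "\<dots> \<le> c * (c * (x \<bullet> x))"
    using le[of x] c by simp
  finally have "(norm ?y)\<^sup>2 \<le> (c * norm x)\<^sup>2"
    by (simp add: power2_norm_eq_inner power_mult_distrib power2_eq_square[of c])
  then show ?thesis using c by (simp add: power2_le_iff_abs_le)
qed

text \<open>With a = By and y = Qa, the form bound gives a . y at least l |a|^2, and replacing y by
  g costs at most |a| k |y|, which is at most k L |a|^2.\<close>

lemma inner_ge_of_relative_error:
  fixes B Q :: "real^'n^'n"
  assumes inv: "Q ** B = mat 1"
    and lower: "\<And>x. l * (x \<bullet> x) \<le> x \<bullet> (Q *v x)"
    and bound: "\<And>x. norm (Q *v x) \<le> L * norm x"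
    and near: "norm (y - g) \<le> k * norm y" and k: "0 \<le> k"
  shows "(l - k * L) * (norm (B *v y))\<^sup>2 \<le> (B *v y) \<bullet> g"
proof -
  let ?a = "B *v y"
  have y: "Q *v ?a = y" by (simp add: matrix_vector_mul_assoc inv)
  have "?a \<bullet> (y - g) \<le> norm ?a * norm (y - g)" by (rule norm_cauchy_schwarz)
  also have "\<dots> \<le> norm ?a * (k * (L * norm ?a))"
    using order_trans[OF near mult_left_mono[OF bound[of ?a, unfolded y] k]]
    by (rule mult_left_mono) simp
  finally have "?a \<bullet> (y - g) \<le> k * L * (norm ?a)\<^sup>2"
    by (simp add: power2_eq_square mult_ac)
  moreover have "l * (norm ?a)\<^sup>2 \<le> ?a \<bullet> y"
    using lower[of ?a] by (simp add: y power2_norm_eq_inner)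
  ultimately show ?thesis by (simp add: inner_diff_right algebra_simps)
qed

lemma inner_ge_norm_mult_norm_of_relative_error:
  fixes B Q :: "real^'n^'n"
  assumes inv: "Q ** B = mat 1" and sym: "transpose B = B"
    and lower: "\<And>x. l * (x \<bullet> x) \<le> x \<bullet> (Q *v x)"
    and bound: "\<And>x. norm (Q *v x) \<le> L * norm x"
    and near: "norm (y - g) \<le> k * norm y" and k: "0 \<le> k" "k < 1"
    and s: "0 \<le> l - k * L"
  shows "(l - k * L) * (norm (B *v y) * norm (B *v g)) \<le> (B *v y) \<bullet> g"
proof (cases "y = 0 \<or> g = 0")
  case False
  then have pos: "0 < y \<bullet> y" "0 < g \<bullet> g" by auto
  let ?s = "l - k * L" and ?i = "y \<bullet> g" and ?X = "(B *v y) \<bullet> g"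
  have X: "?X = (B *v g) \<bullet> y"
    by (simp add: inner_commute[of _ y] inner_matrix_vector_transpose[of y] sym)
  have "(norm (y - g))\<^sup>2 \<le> (k * norm y)\<^sup>2"
    using near by (rule power_mono) simp
  then have near2: "(1 - k\<^sup>2) * (y \<bullet> y) + g \<bullet> g \<le> 2 * ?i"
    by (simp add: power2_norm_eq_inner power_mult_distrib inner_diff_left inner_diff_right
        inner_commute algebra_simps)
  have k2: "k\<^sup>2 < 1" using k by (simp add: power_less_one_iff abs_square_less_1)
  then have "0 < (1 - k\<^sup>2) * (y \<bullet> y) + g \<bullet> g"
    using pos by (intro add_pos_pos mult_pos_pos) auto
  then have i: "0 < ?i" using near2 by linarith
  \<comment> \<open>The inequality 4ab \<le> (a + b)^2 turns \<open>near2\<close> into cos^2 \<ge> 1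
    - k^2 for the angle between y and g. This form is invariant under scaling and symmetric in the
    two vectors.\<close>
  have "4 * ((1 - k\<^sup>2) * (y \<bullet> y) * (g \<bullet> g)) \<le> ((1 - k\<^sup>2) * (y \<bullet> y) + g \<bullet> g)\<^sup>2"
    using zero_le_power2[of "(1 - k\<^sup>2) * (y \<bullet> y) - g \<bullet> g"]
    by (simp add: power2_eq_square algebra_simps)
  also have "\<dots> \<le> (2 * ?i)\<^sup>2"
    using near2 \<open>0 < (1 - k\<^sup>2) * (y \<bullet> y) + g \<bullet> g\<close> by (intro power_mono) auto
  finally have angle: "(1 - k\<^sup>2) * ((y \<bullet> y) * (g \<bullet> g)) \<le> ?i\<^sup>2"
    by (simp add: power_mult_distrib mult.assoc)
  \<comment> \<open>The distance from a to the line of b is |a| times the sine of the angle, so the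
    angle condition is a relative error bound for the projection.\<close>
  have projection: "norm (a - (a \<bullet> b / (b \<bullet> b)) *\<^sub>R b) \<le> k * norm a"
    if "0 < b \<bullet> b" "(1 - k\<^sup>2) * ((a \<bullet> a) * (b \<bullet> b)) \<le> (a \<bullet> b)\<^sup>2" for a b :: "real^'n"
  proof -
    have "(norm (a - (a \<bullet> b / (b \<bullet> b)) *\<^sub>R b))\<^sup>2 = a \<bullet> a - (a \<bullet> b)\<^sup>2 / (b \<bullet> b)"
      using that(1) unfolding power2_norm_eq_inner
      by (simp add: inner_diff_left inner_diff_right inner_commute power2_eq_square)
    also have "\<dots> \<le> k\<^sup>2 * (a \<bullet> a)"
    proof -
      have "(1 - k\<^sup>2) * (a \<bullet> a) \<le> (a \<bullet> b)\<^sup>2 / (b \<bullet> b)"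
        using that by (simp add: pos_le_divide_eq mult_ac)
      then show ?thesis by (simp add: algebra_simps)
    qed
    finally have "(norm (a - (a \<bullet> b / (b \<bullet> b)) *\<^sub>R b))\<^sup>2 \<le> (k * norm a)\<^sup>2"
      by (simp add: power2_norm_eq_inner power_mult_distrib)
    then show ?thesis by (rule power2_le_imp_le) (simp add: k)
  qed
  have "?s * (norm (B *v y))\<^sup>2 \<le> (B *v y) \<bullet> ((?i / (g \<bullet> g)) *\<^sub>R g)"
    using pos angle k
    by (intro inner_ge_of_relative_error[OF inv lower bound] projection) auto
  then have 1: "?s * (norm (B *v y))\<^sup>2 \<le> ?i / (g \<bullet> g) * ?X"
    by simp
  have "?s * (norm (B *v g))\<^sup>2 \<le> (B *v g) \<bullet> ((g \<bullet> y / (y \<bullet> y)) *\<^sub>R y)"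
    using pos angle k
    by (intro inner_ge_of_relative_error[OF inv lower bound] projection)
      (auto simp: inner_commute mult_ac)
  then have 2: "?s * (norm (B *v g))\<^sup>2 \<le> ?i / (y \<bullet> y) * ?X"
    by (simp add: X inner_commute[of g y])
  \<comment> \<open>The sign of \<open>?X\<close> is needed to multiply \<open>1\<close> by
    \<open>2\<close> and to take the square root at the end.\<close>
  have "0 \<le> ?i / (g \<bullet> g) * ?X" 
    by (rule order_trans[OF _ 1]) (intro mult_nonneg_nonneg s zero_le_power2)
  then have X_nonneg: "0 \<le> ?X"
    using i pos by (simp add: zero_le_mult_iff zero_le_divide_iff)
  have "(?s * (norm (B *v y))\<^sup>2) * (?s * (norm (B *v g))\<^sup>2)
      \<le> (?i / (g \<bullet> g) * ?X) * (?i / (y \<bullet> y) * ?X)"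
    using s i X_nonneg pos by (intro mult_mono[OF 1 2]) auto
  \<comment> \<open>The two projection coefficients multiply to the squared cosine, which is at most
    1.\<close>
  also have "\<dots> = (?i\<^sup>2 / ((y \<bullet> y) * (g \<bullet> g))) * ?X\<^sup>2"
    by (simp add: power2_eq_square mult_ac)
  also have "\<dots> \<le> 1 * ?X\<^sup>2"
    using pos Cauchy_Schwarz_ineq[of y g]
    by (intro mult_right_mono) (auto simp: divide_le_eq_1)
  finally have "(?s * (norm (B *v y) * norm (B *v g)))\<^sup>2 \<le> ?X\<^sup>2"
    by (simp add: power2_eq_square mult_ac)
  then show ?thesis using X_nonneg by (rule power2_le_imp_le)
qed auto

lemma loewner_inverse_inner_ge:
  fixes M :: "real^'p^'m"
  defines "B \<equiv> M ** transpose M"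
  assumes inv: "invertible B"
    and lo: "l *\<^sub>R mat 1 \<preceq>\<^sub>L matrix_inv B" and up: "matrix_inv B \<preceq>\<^sub>L L *\<^sub>R mat 1"
    and l: "0 < l" "l < L"
    and near: "norm (y - g) \<le> k * norm y" and k: "0 \<le> k" "k < 1"
    and s: "0 \<le> l - k * L"
  shows "(l - k * L) * (norm (B *v y) * norm (B *v g)) \<le> (B *v y) \<bullet> g"
proof -
  \<comment> \<open>\<open>matrix_inv\<close> is a Hilbert choice; invertibility ensures that the
    chosen matrix is an inverse.\<close>
  have QB: "matrix_inv B ** B = mat 1"
    using inv unfolding invertible_def matrix_inv_def by (rule someI2_ex) blast
  have mat_inner: "x \<bullet> ((c *\<^sub>R mat 1) *v x) = c * (x \<bullet> x)" for c and x :: "real^'m"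
    by (simp add: scaleR_matrix_vector_assoc[symmetric])
  have lower: "l * (x \<bullet> x) \<le> x \<bullet> (matrix_inv B *v x)"
    and upper: "x \<bullet> (matrix_inv B *v x) \<le> L * (x \<bullet> x)" for x
    using lo up
    by (auto simp: loewner_le_def matrix_vector_mult_diff_rdistrib inner_diff_right mat_inner)
  \<comment> \<open>The Loewner order asserts symmetry of the difference; adding back the multiple
    of the identity transfers it to the inverse.\<close>
  have "transpose (matrix_inv B) = transpose (matrix_inv B - l *\<^sub>R mat 1) + l *\<^sub>R mat 1"
    by (simp add: vec_eq_iff transpose_def mat_def)
  also have "\<dots> = matrix_inv B"
    using lo by (simp add: loewner_le_def)
  finally have sym: "transpose (matrix_inv B) = matrix_inv B" .
  have nonneg: "0 \<le> x \<bullet> (matrix_inv B *v x)" for x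
    by (rule order_trans[OF _ lower]) (simp add: l less_imp_le)
  have bound: "norm (matrix_inv B *v x) \<le> L * norm x" for x
    using norm_mult_le_of_loewner_le[OF sym nonneg upper] l by simp
  have "transpose B = B"
    by (simp add: B_def matrix_transpose_mul transpose_transpose)
  from inner_ge_norm_mult_norm_of_relative_error[OF QB this lower bound near k s]
  show ?thesis .
qed

section \<open>Derivatives of Lipschitz maps, and averages over time\<close>

lemma norm_has_derivative_le_lipschitz:
  fixes F :: "'a::real_normed_vector \<Rightarrow> 'b::real_normed_vector"
  assumes der: "(F has_derivative D) (at u)" and lip: "c-lipschitz_on UNIV F"
  shows "norm (D h) \<le> c * norm h"
proof (cases "h = 0")
  case False
  have "linear D" using der by (rule has_derivative_linear)
  have "norm (D h) \<le> (c + e) * norm h" if "0 < e" for e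
  proof -
    from der \<open>0 < e\<close> obtain d where d: "0 < d"
      and approx: "\<And>y. norm (y - u) < d \<Longrightarrow> norm (F y - F u - D (y - u)) \<le> e * norm (y - u)"
      unfolding has_derivative_at_alt by blast
    \<comment> \<open>The factor makes |r h| = d/2, inside the range of the first-order
      approximation. Linearity of \<open>D\<close> then allows r to be cancelled, and e is finally
      sent to 0.\<close>
    define r where "r = d / (2 * norm h)"
    have r: "0 < r" "norm (r *\<^sub>R h) < d"
      using d False by (simp_all add: r_def)
    have "r * norm (D h) = norm (D (r *\<^sub>R h))"
      using r \<open>linear D\<close> by (simp add: linear_scale)
    also have "\<dots> \<le> norm (F (u + r *\<^sub>R h) - F u) + e * norm (r *\<^sub>R h)"
      using approx[of "u + r *\<^sub>R h"] r norm_triangle_sub[of "D (r *\<^sub>R h)" "F (u + r *\<^sub>R h) - F u"]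
      by (simp add: norm_minus_commute)
    also have "\<dots> \<le> r * ((c + e) * norm h)"
      using lipschitz_on_normD[OF lip, of "u + r *\<^sub>R h" u] r by (simp add: algebra_simps)
    finally show ?thesis using r by simp
  qed
  then have "norm (D h) / norm h \<le> c + e" if "0 < e" for e
    using that False by (simp add: pos_divide_le_eq)
  then have "norm (D h) / norm h \<le> c" by (rule field_le_epsilon)
  then show ?thesis using False by (simp add: pos_divide_le_eq)
qed (use has_derivative_linear[OF der] in \<open>simp add: linear_0\<close>)

lemma integral_inner_pos_of_deviation:
  fixes V W :: "real \<Rightarrow> 'a::euclidean_space"
  assumes T: "0 < T"
    and V: "integrable (lebesgue_on {0..T}) V" and W: "integrable (lebesgue_on {0..T}) W"
    and dev: "\<And>t. t \<in> {0..T} \<Longrightarrow>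
      norm (V t - time_average T V) * norm (W t - time_average T W) < V t \<bullet> W t"
  shows "0 < (LINT t|lebesgue_on {0..T}. V t) \<bullet> (LINT t|lebesgue_on {0..T}. W t)"
proof -
  let ?N = "lebesgue_on {0..T}" and ?a = "time_average T V" and ?b = "time_average T W"
  \<comment> \<open>This is V . W minus the inner product of the two deviations. It is affine in V
    and W, so their integrability suffices.\<close>
  let ?F = "\<lambda>t. V t \<bullet> ?b + W t \<bullet> ?a - ?a \<bullet> ?b"
  interpret finite_measure ?N by (intro finite_measure_lebesgue_on) auto
  have measure: "measure ?N {0..T} = T" and emeasure: "emeasure ?N {0..T} = T"
    using T by (auto simp: measure_restrict_space emeasure_restrict_space)
  have intV: "(LINT t|?N. V t) = T *\<^sub>R ?a" and intW: "(LINT t|?N. W t) = T *\<^sub>R ?b"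
    using T by (auto simp: time_average_def)
  have intF: "integrable ?N ?F" using V W by auto
  have "0 < ?F t" if "t \<in> {0..T}" for t
    using dev[OF that] norm_cauchy_schwarz[of "V t - ?a" "W t - ?b"]
    by (simp add: inner_diff_left inner_diff_right inner_commute)
  then have "(LINT t|?N. 0) < (LINT t|?N. ?F t)"
    using intF T by (intro integral_less_AE_space AE_I2) (auto simp: emeasure)
  \<comment> \<open>Each of the three terms of \<open>?F\<close> contributes T a . b in absolute
    value, with signs +, + and -.\<close>
  also have "(LINT t|?N. ?F t) = T * (?a \<bullet> ?b)"
    using V W by (simp add: intV intW measure inner_commute)
  finally show ?thesis using T by (simp add: intV intW zero_less_mult_iff)
qed

text \<open>On a finite measure space L^2 embeds in L^1; summing the entries along the coordinate
  axes recovers the vector function.\<close>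

lemma integrable_of_components_square_integrable:
  fixes g :: "real \<Rightarrow> real^'n"
  assumes "\<And>i. square_integrable_on (\<lambda>t. g t $ i) {a..b}"
  shows "integrable (lebesgue_on {a..b}) g"
proof -
  interpret finite_measure "lebesgue_on {a..b}" by (intro finite_measure_lebesgue_on) auto
  have comp: "integrable (lebesgue_on {a..b}) (\<lambda>t. g t $ i)" for i
    using assms[of i] by (auto simp: square_integrable_on_def intro: square_integrable_imp_integrable)
  have "integrable (lebesgue_on {a..b}) (\<lambda>t. \<Sum>i\<in>UNIV. (g t $ i) *\<^sub>R axis i 1)"
    by (intro Bochner_Integration.integrable_sum integrable_scaleR_left comp)
  also have "(\<lambda>t. \<Sum>i\<in>UNIV. (g t $ i) *\<^sub>R axis i 1) = g"
    by (rule ext) (simp add: basis_expansion scalar_mult_eq_scaleR[symmetric])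
  finally show ?thesis .
qed

lemma grad_eq: "GDERIV F x :> D \<Longrightarrow> grad F x = D"
  unfolding grad_def
proof (rule the_equality)
  fix E assume "GDERIV F x :> D" "GDERIV F x :> E"
  then have "(\<lambda>h. h \<bullet> D) = (\<lambda>h. h \<bullet> E)"
    unfolding gderiv_def by (rule has_derivative_unique)
  then show "E = D" by (metis vector_eq_ldot)
qed

section \<open>The pointwise deviation bound and the descent property\<close>

theorem theorem1:
  fixes T \<alpha> \<gamma> \<beta> \<eta> lam_minus lam_plus :: real
    and f :: "real \<Rightarrow> real^'n \<Rightarrow> real^'m \<Rightarrow> real^'n"
    and L :: "real \<Rightarrow> real^'n \<Rightarrow> real^'m \<Rightarrow> real"
    and G :: "real^'n \<Rightarrow> real"
    and \<phi> :: "real^'p \<Rightarrow> real \<Rightarrow> real^'n \<Rightarrow> real"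
    and \<T> :: "real^'p \<Rightarrow> real^'m \<Rightarrow> real \<Rightarrow> real^'n \<Rightarrow> real^'m"
    and us :: "real^'p \<Rightarrow> real \<Rightarrow> real^'n \<Rightarrow> real^'m"
    and z p :: "real^'p \<Rightarrow> real^'n \<Rightarrow> real \<Rightarrow> real^'n"
    and J :: "real^'n \<Rightarrow> real^'p \<Rightarrow> real"
    and v w :: "real^'p \<Rightarrow> real^'n \<Rightarrow> real \<Rightarrow> real^'p"
    and M :: "real^'p \<Rightarrow> real^'m \<Rightarrow> real \<Rightarrow> real^'n \<Rightarrow> real^'p^'m"
  defines "\<T> \<equiv> control_op \<alpha> f L \<phi>"
    and "M \<equiv> M_mat \<T>"
    and "J \<equiv> \<lambda>x \<theta>. cost T L G (us \<theta>) (z \<theta> x)"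
    and "v \<equiv> \<lambda>\<theta> x. v_integrand \<T> f L \<theta> (us \<theta>) (z \<theta> x) (p \<theta> x)"
    and "w \<equiv> \<lambda>\<theta> x. w_integrand \<T> f L \<theta> (us \<theta>) (z \<theta> x) (p \<theta> x)"
  assumes T_pos: "T > 0" and alpha_pos: "\<alpha> > 0"
    and f_diff: "\<And>t y u. t \<in> {0..T} \<Longrightarrow> (\<lambda>(y, u). f t y u) differentiable (at (y, u))"
    and L_diff: "\<And>t y u. t \<in> {0..T} \<Longrightarrow> (\<lambda>(y, u). L t y u) differentiable (at (y, u))"
    and G_diff: "\<And>y. G differentiable (at y)"
    and phi_diff: "\<And>\<theta> t y. t \<in> {0..T} \<Longrightarrow> \<phi> \<theta> t differentiable (at y)"
    and feedback: "\<And>\<theta>. is_feedback_control T \<alpha> f L \<phi> \<theta> (us \<theta>)"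
    and trajectory: "\<And>\<theta> x. is_trajectory T f (us \<theta>) x (z \<theta> x)"
    and running_cost_integrable:
      "\<And>\<theta> x. integrable (lebesgue_on {0..T}) (\<lambda>s. L s (z \<theta> x s) (us \<theta> s (z \<theta> x s)))"
    and adjoint_trajectory: "\<And>\<theta> x. is_adjoint T f L G (us \<theta>) (z \<theta> x) (p \<theta> x)"
    and gradient_representation:
      "\<And>\<theta> x. GDERIV (J x) \<theta> :> (LINT t|lebesgue_on {0..T}. v \<theta> x t)"
    and gamma: "0 < \<gamma>" "\<gamma> < 1"
    and contractive:
      "\<And>\<theta> t y. t \<in> {0..T} \<Longrightarrow> \<gamma>-lipschitz_on UNIV (\<lambda>u. \<T> \<theta> u t y)"
    and T_C1: "C1_on (UNIV \<times> {0..T} \<times> UNIV \<times> UNIV) (\<lambda>(\<theta>, t, u, y). \<T> \<theta> u t y)"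
    and beta: "\<beta> > 0"
    and singular_values:
      "\<And>\<theta> t u y. t \<in> {0..T} \<Longrightarrow> sqrt (\<gamma> / \<beta>) \<le> sigma_min (M \<theta> u t y) \<and>
         sigma_min (M \<theta> u t y) \<le> sigma_max (M \<theta> u t y) \<and>
         sigma_max (M \<theta> u t y) \<le> 1 / sqrt \<beta>"
    and lam: "0 < lam_minus" "lam_minus < lam_plus"
    and eigenvalue_bounds:
      "\<And>\<theta> t u y. t \<in> {0..T} \<Longrightarrow>
         lam_minus *\<^sub>R mat 1 \<preceq>\<^sub>L matrix_inv (M \<theta> u t y ** transpose (M \<theta> u t y)) \<and>
         matrix_inv (M \<theta> u t y ** transpose (M \<theta> u t y)) \<preceq>\<^sub>L lam_plus *\<^sub>R mat 1"
    and eta: "\<eta> > 0"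
    and residual_bound:
      "\<And>\<theta> x t. t \<in> {0..T} \<Longrightarrow>
         norm (control_residual f L t (z \<theta> x t) (us \<theta> t (z \<theta> x t)) (p \<theta> x t)) \<ge> \<eta>"
    and v_L2: "\<And>\<theta> x i. square_integrable_on (\<lambda>t. v \<theta> x t $ i) {0..T}"
    and w_L2: "\<And>\<theta> x i. square_integrable_on (\<lambda>t. w \<theta> x t $ i) {0..T}"
    and v_deviation:
      "\<And>\<theta> x t. t \<in> {0..T} \<Longrightarrow> norm (v \<theta> x t - time_average T (v \<theta> x))
         < norm (M \<theta> (us \<theta> t (z \<theta> x t)) t (z \<theta> x t) *v v \<theta> x t) * sqrt (lam_minus - \<gamma> * lam_plus)"
    and w_deviation:
      "\<And>\<theta> x t. t \<in> {0..T} \<Longrightarrow> norm (w \<theta> x t - time_average T (w \<theta> x))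
         < norm (M \<theta> (us \<theta> t (z \<theta> x t)) t (z \<theta> x t) *v w \<theta> x t) * sqrt (lam_minus - \<gamma> * lam_plus)"
  shows "\<forall>x \<theta>. descent_direction (J x) \<theta> (- (LINT t|lebesgue_on {0..T}. w \<theta> x t))"
proof (intro allI)
  fix x :: "real^'n" and \<theta> :: "real^'p"
  let ?N = "lebesgue_on {0..T}" and ?s = "lam_minus - \<gamma> * lam_plus"
  have dev: "norm (v \<theta> x t - time_average T (v \<theta> x)) * norm (w \<theta> x t - time_average T (w \<theta> x))
      < v \<theta> x t \<bullet> w \<theta> x t" if t: "t \<in> {0..T}" for t
  proof -
    define y u where "y = z \<theta> x t" and "u = us \<theta> t y"
    define M0 where "M0 = M \<theta> u t y"
    define K where "K = jacobian (\<lambda>u'. \<T> \<theta> u' t y) (at u)"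
    define A where "A = mat 1 - K"
    define g where "g = control_residual f L t y u (p \<theta> x t)"
    \<comment> \<open>Moving the inverse onto the residual gives v = M0^T q beside w = M0^T g, so
      both integrands share the matrix and only q and g have to be compared.\<close>
    define q where "q = transpose (matrix_inv A) *v g"
    let ?B = "M0 ** transpose M0"

    \<comment> \<open>Joint differentiability holds only within the slab, since t may be an end
      point. Varying u alone stays in the slab, and u ranges over the whole space, so an ordinary
      derivative results.\<close>
    have "(\<lambda>u'. \<T> \<theta> u' t y) differentiable (at u)"
    proof -
      let ?S = "UNIV \<times> {0..T} \<times> UNIV \<times> UNIV" and ?F = "\<lambda>(\<theta>, t, u, y). \<T> \<theta> u t y"
      obtain D where D: "(?F has_derivative D) (at (\<theta>, t, u, y) within ?S)"
        using T_C1 t unfolding C1_on_def by fastforce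
      have "((\<lambda>u'. ?F (\<theta>, t, u', y)) has_derivative (\<lambda>h. D (0, 0, h, 0))) (at u)"
      proof (rule has_derivative_in_compose[where g = ?F and f = "\<lambda>u'. (\<theta>, t, u', y)"
            and f' = "\<lambda>h. (0, 0, h, 0)"])
        show "((\<lambda>u'. (\<theta>, t, u', y)) has_derivative (\<lambda>h. (0, 0, h, 0))) (at u)"
          by (intro has_derivative_Pair has_derivative_const has_derivative_ident)
        show "(?F has_derivative D) (at (\<theta>, t, u, y) within range (\<lambda>u'. (\<theta>, t, u', y)))"
          using t by (intro has_derivative_subset[OF D]) auto
      qed
      then show ?thesis by (auto simp: differentiable_def)
    qed
    then have "((\<lambda>u'. \<T> \<theta> u' t y) has_derivative (\<lambda>h. K *v h)) (at u)"
      by (simp add: jacobian_works K_def)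
    then have K: "norm (K *v h) \<le> \<gamma> * norm h" for h
      by (rule norm_has_derivative_le_lipschitz) (rule contractive[OF t])
    \<comment> \<open>A kernel vector of A is fixed by K, which shrinks norms by \<gamma> <
      1.\<close>
    have "h = 0" if "A *v h = 0" for h
    proof -
      have "h = K *v h" using that by (simp add: A_def matrix_vector_mult_diff_rdistrib)
      with K[of h] have "(1 - \<gamma>) * norm h \<le> 0" by (simp add: algebra_simps)
      with gamma show ?thesis by (simp add: mult_le_0_iff)
    qed
    then have "invertible A"
      by (simp add: invertible_left_inverse matrix_left_invertible_ker)
    then have "matrix_inv A ** A = mat 1"
      unfolding invertible_def matrix_inv_def by (rule someI2_ex) blast
    then have "transpose A *v q = g"
      by (simp add: q_def matrix_vector_mul_assoc matrix_transpose_mul[symmetric])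
    moreover have "transpose A = mat 1 - transpose K"
      by (simp add: A_def vec_eq_iff transpose_def mat_def)
    ultimately have "q - g = transpose K *v q"
      by (auto simp: matrix_vector_mult_diff_rdistrib)
    then have near: "norm (q - g) \<le> \<gamma> * norm q"
      using norm_transpose_mult_le[OF K] gamma by simp

    have v: "v \<theta> x t = transpose M0 *v q"
      by (simp add: v_def v_integrand_def du_dtheta_def J_mat_def y_def u_def M0_def M_def q_def
          A_def K_def g_def matrix_transpose_mul matrix_vector_mul_assoc)
    have w: "w \<theta> x t = transpose M0 *v g"
      by (simp add: w_def w_integrand_def y_def u_def M0_def M_def g_def)
    have Mv: "M0 *v v \<theta> x t = ?B *v q" and Mw: "M0 *v w \<theta> x t = ?B *v g"
      by (simp_all add: v w matrix_vector_mul_assoc)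
    have vw: "v \<theta> x t \<bullet> w \<theta> x t = (?B *v q) \<bullet> g"
      unfolding Mv[symmetric] by (simp add: w inner_matrix_vector_transpose transpose_transpose)

    have dev_v: "norm (v \<theta> x t - time_average T (v \<theta> x)) < norm (?B *v q) * sqrt ?s"
      using v_deviation[OF t, of \<theta> x] by (simp only: Mv flip: y_def u_def M0_def)
    have dev_w: "norm (w \<theta> x t - time_average T (w \<theta> x)) < norm (?B *v g) * sqrt ?s"
      using w_deviation[OF t, of \<theta> x] by (simp only: Mw flip: y_def u_def M0_def)
    \<comment> \<open>As \<open>sqrt\<close> is negative on negative arguments, the strict deviation bound forces \<open>s > 0\<close>.\<close>
    have "0 < norm (?B *v q) * sqrt ?s" by (rule le_less_trans[OF norm_ge_zero dev_v])
    then have s: "0 < ?s" by (auto simp: zero_less_mult_iff)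

    \<comment> \<open>Positivity of the lower singular value bound makes the matrix in the
      eigenvalue bounds a genuine inverse.\<close>
    have "0 < sqrt (\<gamma> / \<beta>)" using gamma beta by simp
    also have "\<dots> \<le> sigma_min M0" using singular_values[OF t] by (simp add: M0_def)
    finally have inv: "invertible ?B" by (rule invertible_gram_if_sigma_min_pos)
    have "?s * (norm (?B *v q) * norm (?B *v g)) \<le> (?B *v q) \<bullet> g"
      using eigenvalue_bounds[OF t, of \<theta> u y] s lam gamma near
      by (intro loewner_inverse_inner_ge inv) (simp_all add: M0_def)
    \<comment> \<open>The two factors \<open>sqrt ?s\<close> multiply to \<open>?s\<close>, exactly
      the constant of the symmetric bound.\<close>
    moreover have "norm (v \<theta> x t - time_average T (v \<theta> x)) * norm (w \<theta> x t - time_average T (w \<theta> x))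
        < (norm (?B *v q) * sqrt ?s) * (norm (?B *v g) * sqrt ?s)"
      using dev_v dev_w by (rule mult_strict_mono') auto
    moreover have "(norm (?B *v q) * sqrt ?s) * (norm (?B *v g) * sqrt ?s)
        = (sqrt ?s * sqrt ?s) * (norm (?B *v q) * norm (?B *v g))"
      by (simp only: mult_ac)
    moreover have "sqrt ?s * sqrt ?s = ?s" using s by simp
    ultimately show ?thesis by (simp only: vw)
  qed
  have "integrable ?N (v \<theta> x)" "integrable ?N (w \<theta> x)"
    using v_L2 w_L2 by (auto intro: integrable_of_components_square_integrable)
  then have "0 < (LINT t|?N. v \<theta> x t) \<bullet> (LINT t|?N. w \<theta> x t)"
    using T_pos dev by (intro integral_inner_pos_of_deviation)
  then show "descent_direction (J x) \<theta> (- (LINT t|?N. w \<theta> x t))"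
    by (simp add: descent_direction_def grad_eq[OF gradient_representation])
qed

end
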